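(* Let $n\geq 2$ be an integer and let $m\geq 1$ be an integer. Let $\rho(n,m)$ be the number of Rumer diagrams on $n$ atoms with $m$ valence bonds. Then $$\rho(n,m)=\left|\begin{array}{cc}\binom{m+n-1}{n-1} & \binom{m+n-2}{n-1}\\ \binom{m+n-1}{n-2} & \binom{m+n-2}{n-2}\end{array}\right|,$$ where the right-hand side is a $2\times 2$ determinant of binomial coefficients.
   Context: A valence scheme on $n$ atoms with $m$ valence bonds is a graph without loops, with multiple edges allowed, on the vertices $1,\ldots,n$, with $m$ edges (counted with multiplicity) $(i_1,j_1),\ldots,(i_m,j_m)$, $1\leq i_s<j_s\leq n$. That is, it is a multiset of size $m$ of pairs $(i,j)$ with $1\leq i<j\leq n$ (the order of the edges is irrelevant). The vertices $1,\ldots,n$ are placed clockwise on a circle in this order, and each edge $(i_s,j_s)$ is drawn as the straight segment with endpoints $i_s$ and $j_s$. A Rumer diagram is a valence scheme with no intersecting edges, i.e. no two edges $(i,j)$, $(k,\ell)$ of it satisfy $i<k<j<\ell$ (edges sharing an endpoint, and repeated edges, are not regarded as intersecting). Vertices of degree $0$ are allowed. *)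

theory Defs
  imports "HOL-Analysis.Determinants" "HOL-Library.Multiset"
begin

text \<open>
  An edge between the vertices \<open>i\<close> and \<open>j\<close> is the pair \<open>(i, j)\<close> with \<open>i < j\<close>; the multiplicity
  of an edge is its multiplicity in the multiset.
\<close>

definition valence_scheme :: "nat \<Rightarrow> nat \<Rightarrow> (nat \<times> nat) multiset \<Rightarrow> bool" where
  "valence_scheme n m E \<longleftrightarrow>
     size E = m \<and> (\<forall>(i, j) \<in># E. 1 \<le> i \<and> i < j \<and> j \<le> n)"

text \<open>
  The relation is not symmetric: it says that the chords cross and that \<open>(i, j)\<close> is the one
  with the smaller first endpoint. It is used below for all ordered pairs of edges.
\<close>

definition crosses :: "nat \<times> nat \<Rightarrow> nat \<times> nat \<Rightarrow> bool" where
  "crosses = (\<lambda>(i, j) (k, l). i < k \<and> k < j \<and> j < l)"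

definition rumer_diagram :: "nat \<Rightarrow> nat \<Rightarrow> (nat \<times> nat) multiset \<Rightarrow> bool" where
  "rumer_diagram n m E \<longleftrightarrow>
     valence_scheme n m E \<and> (\<forall>e \<in># E. \<forall>f \<in># E. \<not> crosses e f)"

definition rho :: "nat \<Rightarrow> nat \<Rightarrow> nat" where
  "rho n m = card {E. rumer_diagram n m E}"

end

theory Submission
  imports Defs
begin

text \<open>
  The diagrams are counted by the degree of their last vertex: let \<open>A\<^sub>n(c, h)\<close> be the number of
  Rumer diagrams on \<open>n\<close> vertices with \<open>h\<close> edges that end in the vertex \<open>n\<close> and \<open>c\<close> edges that do
  not, and let \<open>T\<^sub>n(c, h)\<close> count those among them that do not contain the edge \<open>(n - 1, n)\<close>. The
  edges at the last vertex play the role of half-edges that are still open, and reading the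
  vertices from left to right turns a diagram into a ballot sequence. The multisets of left and of
  right endpoints determine the diagram, since a right endpoint has to close the innermost open
  edge. This rigidity is what makes the following recursion work.

  \<^item> The edge between the last two vertices never crosses another edge, so it can be added and
    removed freely: \<open>A\<^sub>n(c, h + 1) = T\<^sub>n(c, h + 1) + A\<^sub>n(c, h)\<close>, and \<open>A\<^sub>n(c, 0) = T\<^sub>n(c, 0)\<close>.

  \<^item> In a diagram on \<open>n + 1\<close> vertices without the edge \<open>(n, n + 1)\<close>, the vertex \<open>n\<close> is either
    isolated and can be deleted, or one edge ending in \<open>n\<close> can be lengthened to end in \<open>n + 1\<close>. Only
    the longest edge ending in \<open>n\<close> can be lengthened without a crossing, and only the shortest
    edge ending in \<open>n + 1\<close> can be shortened again (lemma \<open>lengthen_iff_shorten\<close>), so this is a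
    bijection: \<open>T\<^sub>n\<^sub>+\<^sub>1(c + 1, h) = A\<^sub>n(c + 1, h) + T\<^sub>n\<^sub>+\<^sub>1(c, h + 1)\<close>. If all
    edges end in \<open>n + 1\<close>, only the first case is possible: \<open>T\<^sub>n\<^sub>+\<^sub>1(0, h) = A\<^sub>n(0, h)\<close>.

  With \<open>L\<^sub>k(x)\<close> the number of multisets of size \<open>x\<close> over \<open>k\<close> elements, the recursion is solved by the
  Jacobi--Trudi determinants
  \<open>A\<^sub>n\<^sub>+\<^sub>1(c, h) = L\<^sub>n(c + h) L\<^sub>n(c) - L\<^sub>n(c + h + 1) L\<^sub>n(c - 1)\<close>, and only Pascal's rule
  \<open>L\<^sub>k\<^sub>+\<^sub>1(x) = L\<^sub>k\<^sub>+\<^sub>1(x - 1) + L\<^sub>k(x)\<close> is needed to see it. Finally \<open>\<rho>(n, m) = A\<^sub>n\<^sub>+\<^sub>1(m, 0)\<close>, because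
  a last vertex without edges can be ignored, and Pascal's rule transforms the determinant
  into the claimed one.
\<close>

section \<open>Diagrams by the degree of the last vertex\<close>

definition diagrams_by_last_degree :: "nat \<Rightarrow> nat \<Rightarrow> nat \<Rightarrow> (nat \<times> nat) multiset set" where
  "diagrams_by_last_degree n c h =
     {E. rumer_diagram n (c + h) E \<and> size {#e \<in># E. snd e = n#} = h}"

text \<open>
  The last vertex is \<open>Suc n\<close> here, so that the excluded edge needs no subtraction.
\<close>

definition diagrams_without_last_edge :: "nat \<Rightarrow> nat \<Rightarrow> nat \<Rightarrow> (nat \<times> nat) multiset set" where
  "diagrams_without_last_edge n c h =
     {E \<in> diagrams_by_last_degree (Suc n) c h. (n, Suc n) \<notin># E}"

lemma mem_diagrams_by_last_degree:
  "E \<in> diagrams_by_last_degree n c h \<longleftrightarrow>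
     size E = c + h \<and> size {#e \<in># E. snd e = n#} = h \<and>
     (\<forall>i j. (i, j) \<in># E \<longrightarrow> 1 \<le> i \<and> i < j \<and> j \<le> n) \<and>
     (\<forall>i j k l. (i, j) \<in># E \<longrightarrow> (k, l) \<in># E \<longrightarrow> \<not> (i < k \<and> k < j \<and> j < l))"
  unfolding diagrams_by_last_degree_def rumer_diagram_def valence_scheme_def crosses_def
  by fastforce

lemma finite_diagrams_by_last_degree: "finite (diagrams_by_last_degree n c h)"
proof -
  let ?lists = "{es. set es \<subseteq> {0..n} \<times> {0..n} \<and> length es = c + h}"
  have "diagrams_by_last_degree n c h \<subseteq> mset ` ?lists"
  proof
    fix E assume E: "E \<in> diagrams_by_last_degree n c h"
    obtain es where es: "E = mset es" by (metis ex_mset)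
    have range: "\<And>i j. (i, j) \<in># E \<Longrightarrow> 1 \<le> i \<and> i < j \<and> j \<le> n" and "size E = c + h"
      using E unfolding mem_diagrams_by_last_degree by blast+
    have "e \<in> {0..n} \<times> {0..n}" if "e \<in> set es" for e
      using that range[of "fst e" "snd e"] by (simp add: es mem_Times_iff)
    moreover have "length es = c + h"
      using \<open>size E = c + h\<close> by (simp add: es)
    ultimately show "E \<in> mset ` ?lists" using es by blast
  qed
  moreover have "finite ?lists" by (simp add: finite_lists_length_eq)
  ultimately show ?thesis by (meson finite_imageI finite_subset)
qed

lemma finite_diagrams_without_last_edge: "finite (diagrams_without_last_edge n c h)"
  unfolding diagrams_without_last_edge_def by (simp add: finite_diagrams_by_last_degree)

lemma last_degree_0_iff:
  "size {#e \<in># E. snd e = v#} = 0 \<longleftrightarrow> (\<forall>i. (i, v) \<notin># (E :: (nat \<times> nat) multiset))"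
  by auto

lemma diagrams_last_degree_0:
  "diagrams_by_last_degree (Suc n) m 0 = {E. rumer_diagram n m E}"
proof (rule set_eqI)
  fix E
  have "rumer_diagram n m E \<longleftrightarrow> size E = m \<and>
     (\<forall>i j. (i, j) \<in># E \<longrightarrow> 1 \<le> i \<and> i < j \<and> j \<le> n) \<and>
     (\<forall>i j k l. (i, j) \<in># E \<longrightarrow> (k, l) \<in># E \<longrightarrow> \<not> (i < k \<and> k < j \<and> j < l))"
    unfolding rumer_diagram_def valence_scheme_def crosses_def by fastforce
  moreover have "(\<forall>i j. (i, j) \<in># E \<longrightarrow> 1 \<le> i \<and> i < j \<and> j \<le> n) \<longleftrightarrow>
      (\<forall>i j. (i, j) \<in># E \<longrightarrow> 1 \<le> i \<and> i < j \<and> j \<le> Suc n) \<and> (\<forall>i. (i, Suc n) \<notin># E)"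
    by (metis le_Suc_eq Suc_n_not_le_n)
  ultimately show "E \<in> diagrams_by_last_degree (Suc n) m 0 \<longleftrightarrow> E \<in> {E. rumer_diagram n m E}"
    unfolding mem_diagrams_by_last_degree mem_Collect_eq last_degree_0_iff by auto
qed

section \<open>The recursion\<close>

lemma add_last_edge_iff:
  assumes "1 \<le> n"
  shows "add_mset (n, Suc n) E \<in> diagrams_by_last_degree (Suc n) c (Suc h) \<longleftrightarrow>
    E \<in> diagrams_by_last_degree (Suc n) c h"
proof
  assume E: "E \<in> diagrams_by_last_degree (Suc n) c h"
  have range: "\<And>i j. (i, j) \<in># E \<Longrightarrow> 1 \<le> i \<and> i < j \<and> j \<le> Suc n"
    and nocross: "\<And>i j k l. (i, j) \<in># E \<Longrightarrow> (k, l) \<in># E \<Longrightarrow> \<not> (i < k \<and> k < j \<and> j < l)"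
    and size: "size E = c + h" "size {#e \<in># E. snd e = Suc n#} = h"
    using E unfolding mem_diagrams_by_last_degree by blast+
  have "1 \<le> i \<and> i < j \<and> j \<le> Suc n" if "(i, j) \<in># add_mset (n, Suc n) E" for i j
    using that range[of i j] assms by auto
  moreover have "\<not> (i < k \<and> k < j \<and> j < l)"
    if "(i, j) \<in># add_mset (n, Suc n) E" "(k, l) \<in># add_mset (n, Suc n) E" for i j k l
    using that range[of k l] nocross[of i j k l] by auto
  ultimately show "add_mset (n, Suc n) E \<in> diagrams_by_last_degree (Suc n) c (Suc h)"
    unfolding mem_diagrams_by_last_degree using size by simp
next
  assume E: "add_mset (n, Suc n) E \<in> diagrams_by_last_degree (Suc n) c (Suc h)"
  have range: "\<And>i j. (i, j) \<in># add_mset (n, Suc n) E \<Longrightarrow> 1 \<le> i \<and> i < j \<and> j \<le> Suc n"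
    and nocross: "\<And>i j k l. (i, j) \<in># add_mset (n, Suc n) E \<Longrightarrow>
        (k, l) \<in># add_mset (n, Suc n) E \<Longrightarrow> \<not> (i < k \<and> k < j \<and> j < l)"
    and size: "size (add_mset (n, Suc n) E) = c + Suc h"
      "size {#e \<in># add_mset (n, Suc n) E. snd e = Suc n#} = Suc h"
    using E unfolding mem_diagrams_by_last_degree by blast+
  have "1 \<le> i \<and> i < j \<and> j \<le> Suc n" if "(i, j) \<in># E" for i j
    using that range[of i j] by simp
  moreover have "\<not> (i < k \<and> k < j \<and> j < l)" if "(i, j) \<in># E" "(k, l) \<in># E" for i j k l
    using that nocross[of i j k l] by simp
  moreover have "size E = c + h" "size {#e \<in># E. snd e = Suc n#} = h"
    using size by simp_all
  ultimately show "E \<in> diagrams_by_last_degree (Suc n) c h"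
    unfolding mem_diagrams_by_last_degree by blast
qed

lemma card_split_last_edge:
  assumes "1 \<le> n"
  shows "card (diagrams_by_last_degree (Suc n) c (Suc h)) =
    card (diagrams_without_last_edge n c (Suc h)) + card (diagrams_by_last_degree (Suc n) c h)"
proof -
  let ?add = "add_mset (n, Suc n)"
  have "diagrams_by_last_degree (Suc n) c (Suc h) =
    diagrams_without_last_edge n c (Suc h) \<union> ?add ` diagrams_by_last_degree (Suc n) c h"
    unfolding diagrams_without_last_edge_def
    using add_last_edge_iff[OF assms] by (auto dest!: multi_member_split)
  moreover have "diagrams_without_last_edge n c (Suc h) \<inter>
      ?add ` diagrams_by_last_degree (Suc n) c h = {}"
    by (auto simp: diagrams_without_last_edge_def)
  ultimately show ?thesis
    by (simp add: card_Un_disjoint finite_diagrams_by_last_degree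
        finite_diagrams_without_last_edge card_image inj_on_def)
qed

lemma no_last_edge_of_degree_0:
  "diagrams_without_last_edge n c 0 = diagrams_by_last_degree (Suc n) c 0"
  unfolding diagrams_without_last_edge_def set_eq_iff mem_Collect_eq mem_diagrams_by_last_degree
    last_degree_0_iff by blast

text \<open>
  If the vertex \<open>n\<close> is isolated, then it can be exchanged with \<open>Suc n\<close>. Only right endpoints have
  to be renamed, because \<open>Suc n\<close> is never a left endpoint and the absence of the edge \<open>(n, Suc n)\<close>
  says that \<open>n\<close> is none either.
\<close>

lemma card_isolated_penultimate:
  "card {E \<in> diagrams_without_last_edge n c h. \<forall>i. (i, n) \<notin># E} =
    card (diagrams_by_last_degree n c h)"
proof -
  define s :: "nat \<times> nat \<Rightarrow> nat \<times> nat" where "s = map_prod id (Transposition.transpose n (Suc n))"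
  let ?D = "diagrams_by_last_degree n c h"
  let ?X = "{E \<in> diagrams_without_last_edge n c h. \<forall>i. (i, n) \<notin># E}"
  have s_s: "s (s e) = e" for e
    by (simp add: s_def map_prod_def split: prod.split)
  have image_image: "image_mset s (image_mset s E) = E" for E
    by (simp add: image_mset.compositionality comp_def s_s)
  have mem: "(i, j) \<in># image_mset s E \<longleftrightarrow> s (i, j) \<in># E" for i j E
    by (metis image_eqI imageE s_s set_image_mset)
  have s_simps: "s (i, n) = (i, Suc n)" "s (i, Suc n) = (i, n)"
    "j \<noteq> n \<Longrightarrow> j \<noteq> Suc n \<Longrightarrow> s (i, j) = (i, j)" for i j
    by (simp_all add: s_def)
  have size_image: "size {#e \<in># image_mset s E. snd e = v#} = size {#e \<in># E. snd (s e) = v#}"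
    for v E by (simp add: filter_mset_image_mset)
  have "snd (s e) = n \<longleftrightarrow> snd e = Suc n" "snd (s e) = Suc n \<longleftrightarrow> snd e = n" for e
    by (auto simp: s_def Transposition.transpose_def)
  then have size_last:
    "size {#e \<in># image_mset s E. snd e = n#} = size {#e \<in># E. snd e = Suc n#}"
    "size {#e \<in># image_mset s E. snd e = Suc n#} = size {#e \<in># E. snd e = n#}" for E
    by (simp_all add: size_image)
  have DX: "image_mset s E \<in> ?X" if E: "E \<in> ?D" for E
  proof -
    have range: "\<And>i j. (i, j) \<in># E \<Longrightarrow> 1 \<le> i \<and> i < j \<and> j \<le> n"
      and nocross: "\<And>i j k l. (i, j) \<in># E \<Longrightarrow> (k, l) \<in># E \<Longrightarrow> \<not> (i < k \<and> k < j \<and> j < l)"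
      and size: "size E = c + h" "size {#e \<in># E. snd e = n#} = h"
      using E unfolding mem_diagrams_by_last_degree by blast+
    have old: "j = Suc n \<and> (i, n) \<in># E \<or> j < n \<and> (i, j) \<in># E"
      if "(i, j) \<in># image_mset s E" for i j
      using that range[of i j] range[of i "Suc n"] s_simps[of i] s_simps(3)[of j i] unfolding mem
      by (cases "j = n"; cases "j = Suc n") auto
    have "1 \<le> i \<and> i < j \<and> j \<le> Suc n" if "(i, j) \<in># image_mset s E" for i j
      using old[OF that] range[of i j] range[of i n] by auto
    moreover have "\<not> (i < k \<and> k < j \<and> j < l)"
      if "(i, j) \<in># image_mset s E" "(k, l) \<in># image_mset s E" for i j k l
      using old[OF that(1)] old[OF that(2)] nocross[of i j k l] nocross[of i j k n] by auto
    moreover have "(i, n) \<notin># image_mset s E" for i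
      using old[of i n] by auto
    moreover have "(n, Suc n) \<notin># image_mset s E"
      using old[of n "Suc n"] range[of n n] by auto
    ultimately show ?thesis
      unfolding diagrams_without_last_edge_def mem_Collect_eq mem_diagrams_by_last_degree size_last
      using size by simp
  qed
  have XD: "image_mset s E \<in> ?D" if E: "E \<in> ?X" for E
  proof -
    have range: "\<And>i j. (i, j) \<in># E \<Longrightarrow> 1 \<le> i \<and> i < j \<and> j \<le> Suc n"
      and nocross: "\<And>i j k l. (i, j) \<in># E \<Longrightarrow> (k, l) \<in># E \<Longrightarrow> \<not> (i < k \<and> k < j \<and> j < l)"
      and size: "size E = c + h" "size {#e \<in># E. snd e = Suc n#} = h"
      and no_edge: "(n, Suc n) \<notin># E" and isolated: "\<And>i. (i, n) \<notin># E"
      using E unfolding diagrams_without_last_edge_def mem_Collect_eq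
        mem_diagrams_by_last_degree by blast+
    have old: "j = n \<and> (i, Suc n) \<in># E \<and> i < n \<or> j < n \<and> (i, j) \<in># E"
      if "(i, j) \<in># image_mset s E" for i j
    proof (cases "j = n")
      case True
      with that range[of i "Suc n"] no_edge show ?thesis
        unfolding mem by (auto simp: s_simps less_Suc_eq)
    next
      case False
      with that range[of i j] isolated[of i] show ?thesis
        unfolding mem by (cases "j = Suc n") (auto simp: s_simps)
    qed
    have "1 \<le> i \<and> i < j \<and> j \<le> n" if "(i, j) \<in># image_mset s E" for i j
      using old[OF that] range[of i j] range[of i "Suc n"] by auto
    moreover have "\<not> (i < k \<and> k < j \<and> j < l)"
      if "(i, j) \<in># image_mset s E" "(k, l) \<in># image_mset s E" for i j k l
      using old[OF that(1)] old[OF that(2)] nocross[of i j k l] nocross[of i j k "Suc n"] by auto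
    ultimately show ?thesis
      unfolding mem_diagrams_by_last_degree size_last using size by simp
  qed
  have "bij_betw (image_mset s) ?X ?D"
    by (rule bij_betw_byWitness[where f' = "image_mset s"]) (use DX XD image_image in blast)+
  then show ?thesis by (rule bij_betw_same_card)
qed

text \<open>
  A shorter edge into \<open>Suc n\<close> would cross the shortened edge \<open>(i, n)\<close>, and a longer edge into \<open>n\<close>
  would cross the lengthened edge \<open>(i, Suc n)\<close>. These are the only crossings that moving
  the endpoint can create, and each of the two extremality conditions follows from the absence
  of crossings on the other side.
\<close>

lemma lengthen_iff_shorten:
  "add_mset (i, Suc n) G \<in> diagrams_without_last_edge n c (Suc h) \<and>
     (\<forall>k. (k, Suc n) \<in># G \<longrightarrow> k \<le> i) \<longleftrightarrow>
   add_mset (i, n) G \<in> diagrams_without_last_edge n (Suc c) h \<and>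
     (\<forall>k. (k, n) \<in># G \<longrightarrow> i \<le> k)" (is "?long \<longleftrightarrow> ?short")
proof
  assume long: ?long
  have range: "\<And>p q. (p, q) \<in># add_mset (i, Suc n) G \<Longrightarrow> 1 \<le> p \<and> p < q \<and> q \<le> Suc n"
    and nocross: "\<And>p q k l. (p, q) \<in># add_mset (i, Suc n) G \<Longrightarrow>
        (k, l) \<in># add_mset (i, Suc n) G \<Longrightarrow> \<not> (p < k \<and> k < q \<and> q < l)"
    and size: "size G = c + h" "size {#e \<in># G. snd e = Suc n#} = h"
    and no_edge: "(n, Suc n) \<notin># add_mset (i, Suc n) G"
    and longest: "\<And>k. (k, Suc n) \<in># G \<Longrightarrow> k \<le> i"
    using long unfolding diagrams_without_last_edge_def mem_Collect_eq
      mem_diagrams_by_last_degree by auto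
  have "i < n"
    using range[of i "Suc n"] no_edge by (auto simp: less_Suc_eq)
  have old: "\<not> (p < k \<and> k < q \<and> q < l)" if "(p, q) \<in># G" "(k, l) \<in># G" for p q k l
    using nocross[of p q k l] that by simp
  have cross1: "\<not> (i < k \<and> k < n \<and> n < l)" if "(k, l) \<in># G" for k l
    using longest[of k] range[of k l] that by (auto simp: le_Suc_eq)
  have cross2: "\<not> (p < i \<and> i < q \<and> q < n)" if "(p, q) \<in># G" for p q
    using nocross[of p q i "Suc n"] that by auto
  have "1 \<le> p \<and> p < q \<and> q \<le> Suc n" if "(p, q) \<in># add_mset (i, n) G" for p q
    using that range[of p q] range[of i "Suc n"] \<open>i < n\<close> by auto
  moreover have "\<not> (p < k \<and> k < q \<and> q < l)"
    if "(p, q) \<in># add_mset (i, n) G" "(k, l) \<in># add_mset (i, n) G" for p q k l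
    using that old cross1 cross2 by auto
  moreover have "i \<le> k" if "(k, n) \<in># G" for k
    using nocross[of k n i "Suc n"] that \<open>i < n\<close> by auto
  ultimately show ?short
    unfolding diagrams_without_last_edge_def mem_Collect_eq mem_diagrams_by_last_degree
    using size no_edge by simp
next
  assume short: ?short
  have range: "\<And>p q. (p, q) \<in># add_mset (i, n) G \<Longrightarrow> 1 \<le> p \<and> p < q \<and> q \<le> Suc n"
    and nocross: "\<And>p q k l. (p, q) \<in># add_mset (i, n) G \<Longrightarrow>
        (k, l) \<in># add_mset (i, n) G \<Longrightarrow> \<not> (p < k \<and> k < q \<and> q < l)"
    and size: "size G = c + h" "size {#e \<in># G. snd e = Suc n#} = h"
    and no_edge: "(n, Suc n) \<notin># G"
    and shortest: "\<And>k. (k, n) \<in># G \<Longrightarrow> i \<le> k"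
    using short unfolding diagrams_without_last_edge_def mem_Collect_eq
      mem_diagrams_by_last_degree by auto
  have "i < n"
    using range[of i n] by simp
  have old: "\<not> (p < k \<and> k < q \<and> q < l)" if "(p, q) \<in># G" "(k, l) \<in># G" for p q k l
    using nocross[of p q k l] that by simp
  have cross1: "\<not> Suc n < l" if "(k, l) \<in># G" for k l
    using range[of k l] that by auto
  have cross2: "\<not> (p < i \<and> i < q \<and> q < Suc n)" if "(p, q) \<in># G" for p q
    using nocross[of p q i n] shortest[of p] that by (auto simp: less_Suc_eq)
  have "1 \<le> p \<and> p < q \<and> q \<le> Suc n" if "(p, q) \<in># add_mset (i, Suc n) G" for p q
    using that range[of p q] range[of i n] by auto
  moreover have "\<not> (p < k \<and> k < q \<and> q < l)"
    if "(p, q) \<in># add_mset (i, Suc n) G" "(k, l) \<in># add_mset (i, Suc n) G" for p q k l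
    using that old cross1 cross2 by auto
  moreover have "k \<le> i" if "(k, Suc n) \<in># G" for k
  proof -
    have "k < n"
      using range[of k "Suc n"] no_edge that by (auto simp: less_Suc_eq)
    then show ?thesis
      using nocross[of i n k "Suc n"] that by auto
  qed
  ultimately show ?long
    unfolding diagrams_without_last_edge_def mem_Collect_eq mem_diagrams_by_last_degree
    using size no_edge \<open>i < n\<close> by simp
qed

text \<open>
  An edge ending in \<open>n\<close> exists by assumption on the left, and an edge ending in \<open>Suc n\<close> by the
  positive degree on the right. So the extremal edge to be moved can always be chosen.
\<close>

lemma card_lengthen:
  "card {E \<in> diagrams_without_last_edge n (Suc c) h. \<exists>i. (i, n) \<in># E} =
    card (diagrams_without_last_edge n c (Suc h))"
proof -
  let ?X = "{E \<in> diagrams_without_last_edge n (Suc c) h. \<exists>i. (i, n) \<in># E}"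
  let ?Y = "diagrams_without_last_edge n c (Suc h)"
  define a where "a E = Min {i. (i, n) \<in># E}" for E :: "(nat \<times> nat) multiset"
  define b where "b E = Max {i. (i, Suc n) \<in># E}" for E :: "(nat \<times> nat) multiset"
  define lengthen where "lengthen E = add_mset (a E, Suc n) (E - {#(a E, n)#})" for E
  define shorten where "shorten E = add_mset (b E, n) (E - {#(b E, Suc n)#})" for E
  have fin: "finite {i. (i, v) \<in># E}" for v and E :: "(nat \<times> nat) multiset"
    by (rule finite_subset[of _ "fst ` set_mset E"]) force+
  have X: "\<exists>i G. E = add_mset (i, n) G \<and> (\<forall>k. (k, n) \<in># G \<longrightarrow> i \<le> k)" if "E \<in> ?X" for E
  proof -
    from that have "{i. (i, n) \<in># E} \<noteq> {}" by blast
    then have "(a E, n) \<in># E" "\<forall>k. (k, n) \<in># E \<longrightarrow> a E \<le> k"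
      using Min_in[OF fin] Min_le[OF fin] unfolding a_def by auto
    then show ?thesis by (metis insert_DiffM in_diffD)
  qed
  have Y: "\<exists>i G. E = add_mset (i, Suc n) G \<and> (\<forall>k. (k, Suc n) \<in># G \<longrightarrow> k \<le> i)" if "E \<in> ?Y" for E
  proof -
    from that have "size {#e \<in># E. snd e = Suc n#} = Suc h"
      by (simp add: diagrams_without_last_edge_def mem_diagrams_by_last_degree)
    then obtain e where "e \<in># E" "snd e = Suc n"
      by (metis (mono_tags, lifting) filter_mset_eq_mempty_iff nat.distinct(1) size_empty)
    then have "{i. (i, Suc n) \<in># E} \<noteq> {}" by (cases e) auto
    then have "(b E, Suc n) \<in># E" "\<forall>k. (k, Suc n) \<in># E \<longrightarrow> k \<le> b E"
      using Max_in[OF fin] Max_ge[OF fin] unfolding b_def by auto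
    then show ?thesis by (metis insert_DiffM in_diffD)
  qed
  have a: "a (add_mset (i, n) G) = i" if "\<forall>k. (k, n) \<in># G \<longrightarrow> i \<le> k" for i G
    unfolding a_def using that by (intro Min_eqI fin) auto
  have b: "b (add_mset (i, Suc n) G) = i" if "\<forall>k. (k, Suc n) \<in># G \<longrightarrow> k \<le> i" for i G
    unfolding b_def using that by (intro Max_eqI fin) auto
  have XY: "lengthen E \<in> ?Y \<and> shorten (lengthen E) = E" if "E \<in> ?X" for E
  proof -
    from X[OF that] obtain i G where E: "E = add_mset (i, n) G" "\<forall>k. (k, n) \<in># G \<longrightarrow> i \<le> k"
      by blast
    with that lengthen_iff_shorten[of i n G c h] show ?thesis
      by (simp add: lengthen_def shorten_def a b)
  qed
  have YX: "shorten E \<in> ?X \<and> lengthen (shorten E) = E" if "E \<in> ?Y" for E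
  proof -
    from Y[OF that] obtain i G
      where E: "E = add_mset (i, Suc n) G" "\<forall>k. (k, Suc n) \<in># G \<longrightarrow> k \<le> i"
      by blast
    with that lengthen_iff_shorten[of i n G c h] show ?thesis
      by (auto simp: lengthen_def shorten_def a b)
  qed
  have "bij_betw lengthen ?X ?Y"
    by (rule bij_betw_byWitness[where f' = shorten]) (use XY YX in blast)+
  then show ?thesis by (rule bij_betw_same_card)
qed

lemma card_split_penultimate:
  "card (diagrams_without_last_edge n (Suc c) h) =
    card (diagrams_by_last_degree n (Suc c) h) + card (diagrams_without_last_edge n c (Suc h))"
proof -
  let ?T = "diagrams_without_last_edge n (Suc c) h"
  have "card ?T = card ({E \<in> ?T. \<forall>i. (i, n) \<notin># E} \<union> {E \<in> ?T. \<exists>i. (i, n) \<in># E})"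
    by (rule arg_cong[where f = card]) auto
  also have "\<dots> = card {E \<in> ?T. \<forall>i. (i, n) \<notin># E} + card {E \<in> ?T. \<exists>i. (i, n) \<in># E}"
    by (rule card_Un_disjoint) (auto simp: finite_diagrams_without_last_edge)
  finally show ?thesis
    by (simp add: card_isolated_penultimate card_lengthen)
qed

text \<open>
  If all edges end in \<open>Suc n\<close>, then the vertex \<open>n\<close> is isolated.
\<close>

lemma card_split_penultimate_0:
  "card (diagrams_without_last_edge n 0 h) = card (diagrams_by_last_degree n 0 h)"
proof -
  have "(i, n) \<notin># E" if "E \<in> diagrams_without_last_edge n 0 h" for E i
  proof
    assume "(i, n) \<in># E"
    then obtain G where E: "E = add_mset (i, n) G" by (metis multi_member_split)
    have "size E = h" "size {#e \<in># E. snd e = Suc n#} = h"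
      using that by (auto simp: diagrams_without_last_edge_def mem_diagrams_by_last_degree)
    moreover have "size {#e \<in># G. snd e = Suc n#} \<le> size G"
      by (simp add: size_filter_mset_lesseq)
    ultimately show False by (simp add: E)
  qed
  then have "{E \<in> diagrams_without_last_edge n 0 h. \<forall>i. (i, n) \<notin># E} =
      diagrams_without_last_edge n 0 h" by blast
  with card_isolated_penultimate[of n 0 h] show ?thesis by simp
qed

section \<open>Solution of the recursion\<close>

text \<open>
  This is the number of multisets of size \<open>x - 1\<close> over \<open>k\<close> elements. The shift of the size by one
  gives Pascal's rule without exceptional cases, with value \<open>0\<close> for the size \<open>-1\<close>.
\<close>

fun multichoose_shifted :: "nat \<Rightarrow> nat \<Rightarrow> int" where
  "multichoose_shifted 0 x = (if x = 1 then 1 else 0)"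
| "multichoose_shifted (Suc k) 0 = 0"
| "multichoose_shifted (Suc k) (Suc x) =
     multichoose_shifted (Suc k) x + multichoose_shifted k (Suc x)"

lemma multichoose_shifted_0: "multichoose_shifted k 0 = 0"
  by (cases k) auto

lemma multichoose_shifted_1: "multichoose_shifted k (Suc 0) = 1"
  by (induction k) auto

lemma multichoose_shifted_binomial:
  "multichoose_shifted (Suc k) (Suc x) = int ((k + x) choose k)"
proof (induction k arbitrary: x)
  case 0
  show ?case by (induction x) auto
next
  case (Suc k)
  note IH_k = Suc.IH
  show ?case
  proof (induction x)
    case 0
    show ?case by (simp add: multichoose_shifted_1 del: multichoose_shifted.simps)
  next
    case (Suc x)
    have "multichoose_shifted (Suc (Suc k)) (Suc (Suc x)) =
        int ((Suc k + x) choose Suc k) + int ((k + Suc x) choose k)"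
      by (simp only: multichoose_shifted.simps(3)[of "Suc k" "Suc x"] Suc.IH IH_k)
    then show ?case by simp
  qed
qed

text \<open>
  The right-hand side is the Jacobi--Trudi determinant for the number of semistandard tableaux with
  rows of lengths \<open>c + h\<close> and \<open>c\<close> and with entries up to \<open>n\<close>. In the
  induction step, the formula \<open>T\<close> for the diagrams on \<open>n + 2\<close> vertices without the edge
  \<open>(n + 1, n + 2)\<close> mixes alphabets of \<open>n\<close> and \<open>n + 1\<close> letters. It is proved for all \<open>h\<close> at once,
  because the recursion trades a smaller \<open>c\<close> for a larger \<open>h\<close>.
\<close>

lemma card_diagrams_by_last_degree:
  "int (card (diagrams_by_last_degree (Suc n) c h)) =
     multichoose_shifted n (c + h + 1) * multichoose_shifted n (c + 1)
     - multichoose_shifted n (c + h + 2) * multichoose_shifted n c"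
proof (induction n arbitrary: c h)
  case 0
  have no_edges: "E = {#}" if "E \<in> diagrams_by_last_degree (Suc 0) c h" for E
    using that unfolding mem_diagrams_by_last_degree by (cases E) fastforce+
  have empty: "{#} \<in> diagrams_by_last_degree (Suc 0) c h \<longleftrightarrow> c = 0 \<and> h = 0"
    by (auto simp: mem_diagrams_by_last_degree)
  have "diagrams_by_last_degree (Suc 0) c h = (if c = 0 \<and> h = 0 then {{#}} else {})"
    using no_edges empty by auto
  then show ?case by simp
next
  case (Suc n)
  note IH_n = Suc.IH
  let ?W = "multichoose_shifted n" and ?W' = "multichoose_shifted (Suc n)"
  have T: "int (card (diagrams_without_last_edge (Suc n) c h)) =
      ?W (c + h + 1) * ?W' (c + 1) - ?W (c + h + 2) * ?W' c" for c h
  proof (induction c arbitrary: h)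
    case 0
    show ?case
      by (simp add: card_split_penultimate_0 IH_n multichoose_shifted_0 multichoose_shifted_1
          del: multichoose_shifted.simps(3))
  next
    case (Suc c)
    show ?case
      by (simp add: card_split_penultimate Suc.IH IH_n algebra_simps)
  qed
  show ?case
  proof (induction h)
    case 0
    show ?case
      using T[of c 0] by (simp add: no_last_edge_of_degree_0 algebra_simps)
  next
    case (Suc h)
    show ?case
      using T[of c "Suc h"] Suc.IH by (simp add: card_split_last_edge algebra_simps)
  qed
qed

theorem theorem3p2p1:
  fixes n m :: nat
  assumes "n \<ge> 2" and "m \<ge> 1"
  shows "int (rho n m) =
    det (vector [vector [int ((m + n - 1) choose (n - 1)), int ((m + n - 2) choose (n - 1))],
                 vector [int ((m + n - 1) choose (n - 2)), int ((m + n - 2) choose (n - 2))]]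
         :: int ^ 2 ^ 2)"
proof -
  obtain k j where n: "n = Suc (Suc k)" and m: "m = Suc j"
    using assms by (metis One_nat_def Suc_1 Suc_le_D Suc_le_mono)
  let ?W = "multichoose_shifted (Suc k)" and ?W' = "multichoose_shifted (Suc (Suc k))"
  have "int (rho n m) = ?W' (m + 1) * ?W' (m + 1) - ?W' (m + 2) * ?W' m"
    using card_diagrams_by_last_degree[of n m 0]
    by (simp add: rho_def diagrams_last_degree_0 n del: multichoose_shifted.simps)
  also have "\<dots> = ?W' (Suc m) * ?W (Suc m) - ?W' m * ?W (Suc (Suc m))"
    by (simp add: algebra_simps)
  also have "\<dots> = int ((m + n - 1) choose (n - 1)) * int ((m + n - 2) choose (n - 2))
      - int ((m + n - 2) choose (n - 1)) * int ((m + n - 1) choose (n - 2))"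
    unfolding m multichoose_shifted_binomial by (simp add: n ac_simps)
  finally show ?thesis by (simp add: det_2)
qed

end
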